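(* Let $m\ge 1$, $k\ge 1$ and $0<\epsilon\le 1/2$. For every instance of the online scheduling problem on $m$ identical machines described in the context, $$\Big(\sum_{i}(C_i^S-r_i)^k\Big)^{1/k}\le \frac{4}{\epsilon^2}\,\min\Big(\sum_i (C_i-r_i)^k\Big)^{1/k},$$ where $C_i^S$ are the completion times of $\mathrm{SRPT}$ running on $m$ machines of speed $1+\epsilon$ and the minimum is over all (offline) schedules of the same instance on $m$ machines of speed $1$. That is, $\mathrm{SRPT}$ is $(1+\epsilon)$-speed $\frac{4}{\epsilon^2}$-competitive for the $\ell_k$-norm of flow time on $m$ identical parallel machines.
   Context: Problem: $n$ jobs $J_1,\dots,J_n$ arrive online; job $J_i$ is released at time $r_i\ge 0$ and has processing time $p_i>0$, both unknown before time $r_i$. There are $m$ identical machines. A schedule assigns, at each time, each machine to at most one alive job and each job to at most one machine; preemption and migration of jobs between machines are allowed. A machine of speed $s$ processes $s$ units of work per unit of time. The completion time $C_i$ of $J_i$ is the earliest time $t$ by which $p_i$ units of work have been done on $J_i$ during $(r_i,t]$; its flow time is $C_i-r_i$. The $\ell_k$-norm of flow time of a schedule is $(\sum_i (C_i-r_i)^k)^{1/k}$. The algorithm $\mathrm{SRPT}$ (Shortest Remaining Processing Time) on $m$ machines: at every time, among the released uncompleted jobs, it processes the (at most) $m$ jobs with the least remaining processing time, one per machine, breaking ties arbitrarily. *)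

theory Defs
  imports "HOL-Analysis.Analysis" "HOL-Library.Extended_Real"
begin

text \<open>
  Jobs are the naturals below \<open>n\<close>, machines the naturals below \<open>m\<close>; job \<open>j\<close> has release time
  \<open>r j\<close> and processing time \<open>p j\<close>. A schedule gives, for every time and machine, the job
  (if any) being processed there, so each machine carries at most one job by construction.
\<close>

type_synonym schedule = "real \<Rightarrow> nat \<Rightarrow> nat option"

definition processed :: "nat \<Rightarrow> schedule \<Rightarrow> real \<Rightarrow> nat set" where
  "processed m \<sigma> t = {j. \<exists>h<m. \<sigma> t h = Some j}"

definition work :: "nat \<Rightarrow> real \<Rightarrow> (nat \<Rightarrow> real) \<Rightarrow> schedule \<Rightarrow> nat \<Rightarrow> real \<Rightarrow> real" where
  "work m s r \<sigma> j t = s * measure lebesgue {u \<in> {r j<..t}. j \<in> processed m \<sigma> u}"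

definition remaining ::
  "nat \<Rightarrow> real \<Rightarrow> (nat \<Rightarrow> real) \<Rightarrow> (nat \<Rightarrow> real) \<Rightarrow> schedule \<Rightarrow> nat \<Rightarrow> real \<Rightarrow> real" where
  "remaining m s r p \<sigma> j t = p j - work m s r \<sigma> j t"

definition alive ::
  "nat \<Rightarrow> nat \<Rightarrow> real \<Rightarrow> (nat \<Rightarrow> real) \<Rightarrow> (nat \<Rightarrow> real) \<Rightarrow> schedule \<Rightarrow> real \<Rightarrow> nat set" where
  "alive n m s r p \<sigma> t = {j. j < n \<and> r j \<le> t \<and> 0 < remaining m s r p \<sigma> j t}"

text \<open>
  Preemption and migration are unrestricted. Measurability is only there to make the amount of
  work well defined. The set of alive jobs depends on the schedule itself, through its past.
\<close>

definition valid_schedule ::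
  "nat \<Rightarrow> nat \<Rightarrow> real \<Rightarrow> (nat \<Rightarrow> real) \<Rightarrow> (nat \<Rightarrow> real) \<Rightarrow> schedule \<Rightarrow> bool" where
  "valid_schedule n m s r p \<sigma> \<longleftrightarrow>
     (\<forall>h<m. \<forall>j<n. {t. \<sigma> t h = Some j} \<in> sets lebesgue) \<and>
     (\<forall>t. processed m \<sigma> t \<subseteq> alive n m s r p \<sigma> t) \<and>
     (\<forall>t. \<forall>h<m. \<forall>h'<m. \<forall>j. \<sigma> t h = Some j \<and> \<sigma> t h' = Some j \<longrightarrow> h = h')"

text \<open>
  Ties are broken arbitrarily, so SRPT is a property of schedules: an instance may admit
  several SRPT schedules.
\<close>

definition srpt_schedule ::
  "nat \<Rightarrow> nat \<Rightarrow> real \<Rightarrow> (nat \<Rightarrow> real) \<Rightarrow> (nat \<Rightarrow> real) \<Rightarrow> schedule \<Rightarrow> bool" where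
  "srpt_schedule n m s r p \<sigma> \<longleftrightarrow>
     valid_schedule n m s r p \<sigma> \<and>
     (\<forall>t. card (processed m \<sigma> t) = min m (card (alive n m s r p \<sigma> t)) \<and>
          (\<forall>i \<in> processed m \<sigma> t. \<forall>j \<in> alive n m s r p \<sigma> t - processed m \<sigma> t.
             remaining m s r p \<sigma> i t \<le> remaining m s r p \<sigma> j t))"

definition completes ::
  "nat \<Rightarrow> real \<Rightarrow> (nat \<Rightarrow> real) \<Rightarrow> (nat \<Rightarrow> real) \<Rightarrow> schedule \<Rightarrow> nat \<Rightarrow> bool" where
  "completes m s r p \<sigma> i \<longleftrightarrow> (\<exists>t. p i \<le> work m s r \<sigma> i t)"

text \<open>
  If job \<open>i\<close> completes and \<open>p i > 0\<close>, the least such time exists, since the work done on \<open>i\<close> is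
  continuous in time and vanishes up to \<open>r i\<close>.
\<close>

definition completion_time ::
  "nat \<Rightarrow> real \<Rightarrow> (nat \<Rightarrow> real) \<Rightarrow> (nat \<Rightarrow> real) \<Rightarrow> schedule \<Rightarrow> nat \<Rightarrow> real" where
  "completion_time m s r p \<sigma> i = (LEAST t. p i \<le> work m s r \<sigma> i t)"

text \<open>A schedule that leaves some job unfinished forever has infinite cost.\<close>

definition flow_norm ::
  "nat \<Rightarrow> nat \<Rightarrow> real \<Rightarrow> (nat \<Rightarrow> real) \<Rightarrow> (nat \<Rightarrow> real) \<Rightarrow> real \<Rightarrow> schedule \<Rightarrow> ereal" where
  "flow_norm n m s r p k \<sigma> =
     (if \<forall>i<n. completes m s r p \<sigma> i
      then ereal ((\<Sum>i<n. (completion_time m s r p \<sigma> i - r i) powr k) powr (1 / k))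
      else \<infinity>)"

definition opt_flow_norm ::
  "nat \<Rightarrow> nat \<Rightarrow> real \<Rightarrow> (nat \<Rightarrow> real) \<Rightarrow> (nat \<Rightarrow> real) \<Rightarrow> real \<Rightarrow> ereal" where
  "opt_flow_norm n m s r p k =
     (INF \<sigma> \<in> {\<sigma>. valid_schedule n m s r p \<sigma>}. flow_norm n m s r p k \<sigma>)"

end

theory Submission
  imports Defs
begin

text \<open>
  Write \<open>s = 1 + \<epsilon>\<close>, \<open>F\<^sub>i\<close> and \<open>O\<^sub>i\<close> for the flow times of job \<open>i\<close> under SRPT and under a unit speed
  competitor. SRPT keeps every machine on jobs of remaining size at most \<open>p\<^sub>i\<close> whenever it leaves an
  alive job \<open>i\<close> waiting, so when SRPT completes \<open>i\<close> the competitor is behind by \<open>m \<epsilon> F\<^sub>i\<close> units of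
  work on jobs of original size at most \<open>p\<^sub>i\<close>, up to an additive \<open>2 m p\<^sub>i\<close>: if \<open>V\<^sub>i\<close> is the work the competitor
  still has to do at that time on such jobs, then \<open>m \<epsilon> F\<^sub>i \<le> 2 m p\<^sub>i + V\<^sub>i\<close>. At least half of \<open>V\<^sub>i\<close>
  belongs to jobs \<open>j\<close> with \<open>O\<^sub>j \<ge> V\<^sub>i / (2 m)\<close>, to which \<open>V\<^sub>i\<^sup>k\<close> is charged in proportion to \<open>p\<^sub>j\<close>.
  A job \<open>j\<close> is charged only by SRPT completions of jobs of size at least \<open>p\<^sub>j\<close> during its flow
  interval; since at any time at most \<open>m\<close> jobs have been reduced by SRPT from at least \<open>p\<^sub>j\<close> to below
  \<open>p\<^sub>j\<close>, there are at most \<open>m + m s O\<^sub>j / p\<^sub>j\<close> of them. Convexity of \<open>x\<^sup>k\<close> combines the two terms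
  of \<open>F\<^sub>i\<close> into the factor \<open>7 / \<epsilon> \<le> 4 / \<epsilon>\<^sup>2\<close>.
\<close>

section \<open>Integrating counts, and convexity of powers\<close>

text \<open>The number of sets \<open>X j\<close> containing \<open>v\<close> is a sum of
  indicators, so a pointwise bound on it integrates to a bound on the total measure. This turns
  counts of busy machines into amounts of work.\<close>

lemma card_le_sum_measure:
  fixes X :: "'i \<Rightarrow> real set"
  assumes "finite A" and X: "\<And>j. j \<in> A \<Longrightarrow> X j \<in> sets lebesgue" and Q: "Q \<in> lmeasurable"
  shows "(\<And>v. v \<in> Q \<Longrightarrow> c \<le> card {j \<in> A. v \<in> X j}) \<Longrightarrow>
      real c * measure lebesgue Q \<le> (\<Sum>j\<in>A. measure lebesgue (X j \<inter> Q))"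
    and "(\<And>v. v \<in> Q \<Longrightarrow> card {j \<in> A. v \<in> X j} \<le> c) \<Longrightarrow>
      (\<Sum>j\<in>A. measure lebesgue (X j \<inter> Q)) \<le> real c * measure lebesgue Q"
proof -
  have lm: "X j \<inter> Q \<in> lmeasurable" if "j \<in> A" for j
    using X[OF that] Q by (simp add: fmeasurable_Int_fmeasurable inf_commute)
  have int: "integrable lebesgue (indicat_real (X j \<inter> Q))" if "j \<in> A" for j
    using lm[OF that] by (simp add: fmeasurable_def integrable_indicator_iff del: emeasure_completion)
  have intQ: "integrable lebesgue (indicat_real Q)"
    using Q by (simp add: fmeasurable_def integrable_indicator_iff del: emeasure_completion)
  have cnt: "(\<Sum>j\<in>A. indicat_real (X j \<inter> Q) v) = real (card {j \<in> A. v \<in> X j}) * indicat_real Q v" for v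
  proof (cases "v \<in> Q")
    case True
    have "(\<Sum>j\<in>A. indicat_real (X j \<inter> Q) v) = (\<Sum>j\<in>A. if v \<in> X j then 1 else 0)"
      using True by (intro sum.cong) (auto simp: indicator_def)
    also have "\<dots> = real (card {j \<in> A. v \<in> X j})"
      using assms(1) by (simp add: sum.If_cases Int_def)
    finally show ?thesis using True by simp
  qed simp
  have eq: "(\<Sum>j\<in>A. measure lebesgue (X j \<inter> Q)) =
      integral\<^sup>L lebesgue (\<lambda>v. real (card {j \<in> A. v \<in> X j}) * indicat_real Q v)"
    unfolding cnt[symmetric] using int by (subst Bochner_Integration.integral_sum) auto
  have eqQ: "real c * measure lebesgue Q = integral\<^sup>L lebesgue (\<lambda>v. real c * indicat_real Q v)"
    by simp
  have intS: "integrable lebesgue (\<lambda>v. real (card {j \<in> A. v \<in> X j}) * indicat_real Q v)"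
    unfolding cnt[symmetric] using int by (rule Bochner_Integration.integrable_sum)
  have intc: "integrable lebesgue (\<lambda>v. real c * indicat_real Q v)"
    using intQ by (rule integrable_mult_right)
  show "real c * measure lebesgue Q \<le> (\<Sum>j\<in>A. measure lebesgue (X j \<inter> Q))"
    if "\<And>v. v \<in> Q \<Longrightarrow> c \<le> card {j \<in> A. v \<in> X j}"
    unfolding eq eqQ
  proof (rule integral_mono[OF intc intS])
    show "real c * indicat_real Q v \<le> real (card {j \<in> A. v \<in> X j}) * indicat_real Q v" for v
      using that[of v] by (cases "v \<in> Q") auto
  qed
  show "(\<Sum>j\<in>A. measure lebesgue (X j \<inter> Q)) \<le> real c * measure lebesgue Q"
    if "\<And>v. v \<in> Q \<Longrightarrow> card {j \<in> A. v \<in> X j} \<le> c"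
    unfolding eq eqQ
  proof (rule integral_mono[OF intS intc])
    show "real (card {j \<in> A. v \<in> X j}) * indicat_real Q v \<le> real c * indicat_real Q v" for v
      using that[of v] by (cases "v \<in> Q") auto
  qed
qed

lemma Ioc_lmeasurable: "{a<..b::real} \<in> lmeasurable"
  by (intro bounded_set_imp_lmeasurable) (auto intro: bounded_subset[OF bounded_closed_interval[of a b]])

text \<open>Convexity applied to \<open>a + b\<close> seen as the mean of \<open>a / l\<close> and
  \<open>b / (1 - l)\<close> with weights \<open>l\<close> and \<open>1 - l\<close>. Treating
  \<open>b = 0\<close> apart keeps both points positive.\<close>

lemma powr_add_le_convex:
  fixes a b k l :: real
  assumes "0 < a" "0 \<le> b" "1 \<le> k" "0 < l" "l < 1"
  shows "(a + b) powr k \<le> l * (a / l) powr k + (1 - l) * (b / (1 - l)) powr k"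
proof (cases "b = 0")
  case True
  have "a powr k = l powr k * (a / l) powr k"
    using assms by (simp add: powr_divide)
  also have "l powr k \<le> l powr 1"
    using assms by (intro powr_mono') auto
  finally show ?thesis using True assms by (simp add: mult_right_mono)
next
  case False
  have "((1 - l) *\<^sub>R (b / (1 - l)) + l *\<^sub>R (a / l)) powr k \<le>
      (1 - l) * (b / (1 - l)) powr k + l * (a / l) powr k"
    using assms False by (intro convex_onD[OF powr_convex]) auto
  then show ?thesis using assms by (simp add: add.commute)
qed

section \<open>Schedules\<close>

locale sched =
  fixes n m :: nat and s :: real and r p :: "nat \<Rightarrow> real" and \<sigma> :: schedule
  assumes s_pos: "0 < s"
    and p_pos: "\<And>j. j < n \<Longrightarrow> 0 < p j"
    and valid: "valid_schedule n m s r p \<sigma>"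
begin

abbreviation "P j \<equiv> {u. j \<in> processed m \<sigma> u}"
abbreviation "q \<equiv> remaining m s r p \<sigma>"
abbreviation "\<mu> \<equiv> measure lebesgue"

section \<open>Remaining work as a function of time\<close>

lemma P_sets: "j < n \<Longrightarrow> P j \<in> sets lebesgue"
proof -
  assume j: "j < n"
  have "P j = (\<Union>h\<in>{..<m}. {t. \<sigma> t h = Some j})"
    by (auto simp: processed_def)
  moreover have "{t. \<sigma> t h = Some j} \<in> sets lebesgue" if "h < m" for h
    using valid j that by (auto simp: valid_schedule_def)
  ultimately show ?thesis
    by (metis (no_types, lifting) finite_lessThan lessThan_iff sets.finite_UN)
qed

lemma P_Ioc_lmeasurable: "j < n \<Longrightarrow> P j \<inter> {a<..b} \<in> lmeasurable"
  using P_sets[of j] Ioc_lmeasurable[of a b] by (simp add: fmeasurable_Int_fmeasurable inf_commute)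

lemma P_alive:
  assumes "j \<in> processed m \<sigma> u"
  shows "j < n" "r j \<le> u" "0 < q j u"
  using assms valid by (auto simp: valid_schedule_def alive_def)

lemma finite_processed: "finite (processed m \<sigma> u)"
  by (rule finite_subset[of _ "{..<n}"]) (use P_alive in auto)

lemma card_processed_le: "card (processed m \<sigma> u) \<le> m"
proof -
  have "processed m \<sigma> u \<subseteq> (\<lambda>h. the (\<sigma> u h)) ` {..<m}"
    by (force simp: processed_def)
  then have "card (processed m \<sigma> u) \<le> card ((\<lambda>h. the (\<sigma> u h)) ` {..<m})"
    by (intro card_mono) auto
  also have "\<dots> \<le> m"
    using card_image_le[of "{..<m}"] by simp
  finally show ?thesis .
qed

lemma finite_alive: "finite (alive n m s r p \<sigma> t)"
  by (rule finite_subset[of _ "{..<n}"]) (auto simp: alive_def)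

lemma q_before: "t \<le> r j \<Longrightarrow> q j t = p j"
  by (simp add: remaining_def work_def)

lemma q_diff:
  assumes "j < n" and "a \<le> b"
  shows "q j a - q j b = s * \<mu> (P j \<inter> {a<..b})"
proof -
  have W: "q j t = p j - s * \<mu> (P j \<inter> {r j<..t})" for t
    by (simp add: remaining_def work_def Int_def conj_commute)
  consider "r j \<le> a" | "a < r j" "r j \<le> b" | "b < r j" by linarith
  then show ?thesis
  proof cases
    case 1
    have "P j \<inter> {r j<..b} = (P j \<inter> {r j<..a}) \<union> (P j \<inter> {a<..b})"
      using 1 assms(2) by auto
    moreover have "\<mu> ((P j \<inter> {r j<..a}) \<union> (P j \<inter> {a<..b})) =
        \<mu> (P j \<inter> {r j<..a}) + \<mu> (P j \<inter> {a<..b})"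
      using P_Ioc_lmeasurable[OF assms(1)]
      by (intro measure_Union) (auto simp: fmeasurableD fmeasurableD2 simp del: emeasure_completion)
    ultimately show ?thesis by (simp add: W algebra_simps)
  next
    case 2
    have "\<mu> (P j \<inter> {r j<..b}) = \<mu> (P j \<inter> {a<..b})"
    proof (rule measure_negligible_symdiff[symmetric])
      show "P j \<inter> {r j<..b} \<in> lmeasurable"
        using P_Ioc_lmeasurable[OF assms(1)] by auto
      \<comment> \<open>Validity excludes processing before \<open>r j\<close>. Processing at the
        instant \<open>r j\<close> is allowed but not counted by \<open>work\<close>, and a single
        point is null.\<close>
      have "sym_diff (P j \<inter> {r j<..b}) (P j \<inter> {a<..b}) \<subseteq> {r j}"
        using 2 P_alive(2)[of j] by force
      then show "negligible (sym_diff (P j \<inter> {r j<..b}) (P j \<inter> {a<..b}))"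
        using negligible_sing negligible_subset by blast
    qed
    then show ?thesis using 2 by (simp add: W)
  next
    case 3
    then have "P j \<inter> {a<..b} = {}" using P_alive(2)[of j] by force
    then show ?thesis using 3 assms by (simp add: q_before)
  qed
qed

lemma q_mono: "j < n \<Longrightarrow> a \<le> b \<Longrightarrow> q j b \<le> q j a"
  using q_diff[of j a b] s_pos by (smt (verit) measure_nonneg mult_nonneg_nonneg)

lemma q_lipschitz: "j < n \<Longrightarrow> a \<le> b \<Longrightarrow> q j a - q j b \<le> s * (b - a)"
  using q_diff[of j a b] s_pos Ioc_lmeasurable[of a b]
    measure_mono_fmeasurable[of "P j \<inter> {a<..b}" "{a<..b}" lebesgue] P_Ioc_lmeasurable[of j a b]
  by (auto simp: mult_left_mono)

lemma q_continuous: "j < n \<Longrightarrow> continuous_on X (q j)"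
proof (rule lipschitz_on_continuous_on[where L = s], rule lipschitz_onI)
  fix x y assume "j < n"
  then show "dist (q j x) (q j y) \<le> s * dist x y"
    using q_lipschitz[of j x y] q_lipschitz[of j y x] q_mono[of j x y] q_mono[of j y x]
    by (cases "x \<le> y") (auto simp: dist_real_def abs_if algebra_simps)
qed (use s_pos in auto)

lemma q_isCont: "j < n \<Longrightarrow> isCont (q j) t"
  using q_continuous[of j UNIV] by (simp add: continuous_on_eq_continuous_at)

lemma q_le_p: "j < n \<Longrightarrow> q j t \<le> p j"
  using q_mono[of j "min t (r j)" t] q_before[of "min t (r j)" j] by simp

lemma not_processed_imp_q_eq:
  assumes "j < n" and "a \<le> b" and "\<And>v. a < v \<Longrightarrow> v < b \<Longrightarrow> j \<notin> processed m \<sigma> v"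
  shows "q j b = q j a"
proof -
  have "P j \<inter> {a<..b} \<subseteq> {b}"
    using assms(3) by force
  then have "negligible (P j \<inter> {a<..b})"
    using negligible_sing negligible_subset by blast
  then have "\<mu> (P j \<inter> {a<..b}) = 0"
    by (simp add: negligible_imp_measure0)
  then show ?thesis using q_diff[OF assms(1,2)] by simp
qed

text \<open>Jobs are never overworked: by continuity a negative value is preceded by a zero, and
  from that zero on validity forbids processing \<open>j\<close>.\<close>

lemma q_nonneg: "j < n \<Longrightarrow> 0 \<le> q j t"
proof (rule ccontr)
  assume j: "j < n" and "\<not> 0 \<le> q j t"
  then have neg: "q j t < 0" by simp
  have "q j (min t (r j)) = p j" by (simp add: q_before)
  then obtain c where c: "min t (r j) \<le> c" "c \<le> t" "q j c = 0"
    using IVT2'[of "q j" t 0 "min t (r j)"] neg p_pos[OF j] q_continuous[OF j]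
    by (metis less_eq_real_def min.cobounded1)
  have "q j t = q j c"
  proof (rule not_processed_imp_q_eq[OF j \<open>c \<le> t\<close>])
    fix v assume "c < v"
    then have "q j v \<le> 0" using q_mono[OF j, of c v] c by simp
    then show "j \<notin> processed m \<sigma> v" using P_alive(3)[of j v] by auto
  qed
  then show False using c neg by simp
qed

lemma alive_iff: "j \<in> alive n m s r p \<sigma> t \<longleftrightarrow> j < n \<and> r j \<le> t \<and> 0 < q j t"
  by (auto simp: alive_def)

lemma sum_q_diff_le:
  assumes "A \<subseteq> {..<n}" and "a \<le> b"
  shows "(\<Sum>j\<in>A. q j a - q j b) \<le> real m * s * (b - a)"
proof -
  have "(\<Sum>j\<in>A. \<mu> (P j \<inter> {a<..b})) \<le> real m * \<mu> {a<..b}"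
  proof (rule card_le_sum_measure(2))
    fix v
    have "card {j \<in> A. v \<in> P j} \<le> card (processed m \<sigma> v)"
      by (intro card_mono finite_processed) auto
    then show "card {j \<in> A. v \<in> P j} \<le> m"
      using card_processed_le[of v] by simp
  qed (use assms P_sets Ioc_lmeasurable in \<open>auto intro: finite_subset\<close>)
  then have "s * (\<Sum>j\<in>A. \<mu> (P j \<inter> {a<..b})) \<le> s * (real m * (b - a))"
    using s_pos assms(2) by (intro mult_left_mono) auto
  moreover have "(\<Sum>j\<in>A. q j a - q j b) = s * (\<Sum>j\<in>A. \<mu> (P j \<inter> {a<..b}))"
    unfolding sum_distrib_left using assms q_diff by (intro sum.cong) auto
  ultimately show ?thesis by (simp add: algebra_simps)
qed

section \<open>Completion times and comparison of jobs\<close>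

abbreviation "C \<equiv> completion_time m s r p \<sigma>"

text \<open>The times with no remaining work form a closed set bounded below by \<open>r j\<close>,
  so the \<open>LEAST\<close> in the definition is its attained infimum.\<close>

lemma completion_time:
  assumes j: "j < n" and "completes m s r p \<sigma> j"
  shows "p j \<le> s * (C j - r j)" and "0 < q j t \<longleftrightarrow> t < C j"
proof -
  have iff: "p j \<le> work m s r \<sigma> j t \<longleftrightarrow> q j t \<le> 0" for t
    by (auto simp: remaining_def)
  let ?Z = "{t. q j t \<le> 0}"
  obtain t0 where t0: "q j t0 \<le> 0"
    using assms(2) iff by (auto simp: completes_def)
  have low: "r j \<le> t" if "q j t \<le> 0" for t
    using q_before[of t j] p_pos[OF j] that by force
  have cl: "closed ?Z"
    using q_continuous[OF j, of UNIV] by (intro closed_Collect_le) auto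
  have bb: "bdd_below ?Z" using low by (intro bdd_belowI[of _ "r j"]) auto
  have ne: "?Z \<noteq> {}" using t0 by auto
  have inf: "Inf ?Z \<in> ?Z"
    using closed_contains_Inf[OF ne bb cl] .
  have C: "C j = Inf ?Z"
    unfolding completion_time_def iff
    using inf bb by (intro Least_equality) (auto intro: cInf_lower)
  have iff2: "q j t \<le> 0 \<longleftrightarrow> C j \<le> t" for t
    using C inf bb q_mono[OF j, of "C j" t] cInf_lower[of t ?Z] by auto
  then show "0 < q j t \<longleftrightarrow> t < C j" for t
    by (meson not_le)
  have "q j (C j) \<le> 0" using iff2 by simp
  moreover have "r j \<le> C j" using low calculation by simp
  ultimately show "p j \<le> s * (C j - r j)"
    using q_lipschitz[OF j, of "r j" "C j"] q_before[of "r j" j] by simp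
qed

lemma q_tendsto: "j < n \<Longrightarrow> (q j \<longlongrightarrow> q j t) (at t within X)"
  using continuous_at_imp_continuous_at_within[OF q_isCont] by (simp add: continuous_within)

lemma q_diff_mono:
  assumes "j < n" "l < n" "a \<le> b"
    and "\<And>w. a < w \<Longrightarrow> w < b \<Longrightarrow> l \<in> processed m \<sigma> w \<Longrightarrow> j \<in> processed m \<sigma> w"
  shows "q l a - q l b \<le> q j a - q j b"
proof -
  have meas: "P j \<inter> {a<..b} \<in> sets lebesgue" "P l \<inter> {a<..b} \<in> sets lebesgue"
    using assms P_Ioc_lmeasurable by (auto intro: fmeasurableD)
  have "\<mu> (P l \<inter> {a<..b}) \<le> \<mu> ((P j \<inter> {a<..b}) \<union> {b})"
  proof (rule measure_mono_fmeasurable)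
    show "P l \<inter> {a<..b} \<subseteq> (P j \<inter> {a<..b}) \<union> {b}"
      using assms(4) by force
    show "(P j \<inter> {a<..b}) \<union> {b} \<in> lmeasurable"
      using assms(1) P_Ioc_lmeasurable negligible_imp_measurable[OF negligible_sing]
      by (intro fmeasurable.Un) auto
  qed (rule meas)
  also have "\<dots> \<le> \<mu> (P j \<inter> {a<..b}) + \<mu> {b}"
    using meas by (intro measure_Un_le) auto
  finally have "\<mu> (P l \<inter> {a<..b}) \<le> \<mu> (P j \<inter> {a<..b})" by simp
  then show ?thesis
    using q_diff assms s_pos by (simp add: mult_left_mono)
qed

text \<open>Equal remaining work on an interval makes both jobs receive the same amount on every
  subinterval, and a Borel measure is determined by its values on intervals.\<close>

lemma same_q_imp_same_processing:
  assumes j: "j < n" and l: "l < n" and eq: "\<And>w. a \<le> w \<Longrightarrow> w \<le> z \<Longrightarrow> q j w = q l w"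
  shows "negligible ((P j - P l) \<inter> {a<..z})"
proof -
  \<comment> \<open>Lebesgue measure restricted to \<open>X\<close>, as a Borel measure.\<close>
  define M where "M X = distr (density lebesgue (indicator X)) borel (\<lambda>x::real. x)" for X :: "real set"
  have emM: "emeasure (M X) A = emeasure lebesgue (X \<inter> A)"
    if "X \<in> sets lebesgue" "A \<in> sets borel" for X A
  proof -
    have A: "A \<in> sets lebesgue" using that(2) by auto
    have "emeasure (M X) A = emeasure (density lebesgue (indicator X)) A"
      unfolding M_def using that id_borel_measurable_lebesgue by (subst emeasure_distr) (auto simp: id_def)
    also have "\<dots> = (\<integral>\<^sup>+v. indicator X v * indicator A v \<partial>lebesgue)"
      using that A by (intro emeasure_density) auto
    also have "\<dots> = (\<integral>\<^sup>+v. indicator (X \<inter> A) v \<partial>lebesgue)"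
      by (simp add: indicator_inter_arith)
    finally show ?thesis using that A by (simp del: emeasure_completion)
  qed
  let ?J = "P j \<inter> {a<..z}" and ?L = "P l \<inter> {a<..z}"
  have J: "?J \<in> sets lebesgue" and L: "?L \<in> sets lebesgue"
    using P_Ioc_lmeasurable j l by (auto dest: fmeasurableD)
  have em: "emeasure lebesgue ((P i \<inter> {a<..z}) \<inter> {c<..}) = ennreal (\<mu> (P i \<inter> {max a c<..z}))"
    if "i < n" for i c
  proof -
    have "(P i \<inter> {a<..z}) \<inter> {c<..} = P i \<inter> {max a c<..z}" by auto
    then show ?thesis
      using P_Ioc_lmeasurable[OF that] by (simp add: emeasure_eq_measure2 del: emeasure_completion)
  qed
  have "M ?J = M ?L"
  proof (rule measure_eqI_lessThan)
    show "emeasure (M ?J) {c<..} < \<infinity>" for c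
      using em[OF j] by (simp add: emM[OF J])
    fix c
    show "emeasure (M ?J) {c<..} = emeasure (M ?L) {c<..}"
    proof (cases "max a c \<le> z")
      case True
      then have "s * \<mu> (P j \<inter> {max a c<..z}) = s * \<mu> (P l \<inter> {max a c<..z})"
        using q_diff[OF j True] q_diff[OF l True] eq by auto
      then show ?thesis using s_pos by (simp add: emM J L em j l)
    next
      case False
      then have "{max a c<..z} = {}" by auto
      then show ?thesis by (simp add: emM J L em j l del: greaterThanAtMost_empty_iff)
    qed
  qed (auto simp: M_def)
  have "(P j - P l) \<inter> {a<..z} \<in> sets lebesgue"
    using J L by (metis Diff_Int_distrib2 sets.Diff)
  \<comment> \<open>Equality of the two measures speaks of Borel sets only, so the difference is
    replaced by a Borel part \<open>S\<close> up to a null set. As \<open>S\<close> lies in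
    \<open>?J\<close> and misses \<open>?L\<close>, its measure is zero.\<close>
  then obtain S N N' where SN: "(P j - P l) \<inter> {a<..z} = S \<union> N" "N \<subseteq> N'"
    "N' \<in> null_sets lborel" "S \<in> sets lborel"
    by (rule sets_completionE)
  have "emeasure lebesgue S = emeasure (M ?J) S"
    using SN emM[OF J, of S] by (metis (no_types, lifting) Diff_Int_distrib2 Diff_subset
        Int_absorb1 le_sup_iff order_refl order_trans sets_lborel)
  also have "\<dots> = emeasure lebesgue (?L \<inter> S)"
    using \<open>M ?J = M ?L\<close> emM[OF L, of S] SN by simp
  also have "?L \<inter> S = {}" using SN by auto
  finally have "negligible S"
    using SN(4) by (auto simp: negligible_iff_null_sets null_sets_def simp del: emeasure_completion)
  moreover have "negligible N"
    using SN by (metis negligible_iff_null_sets negligible_subset null_sets_completionI)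
  ultimately show ?thesis using SN by (metis negligible_Un)
qed

text \<open>Jobs finished by \<open>t + y\<close> receive all of their remaining work within a
  window of length \<open>y\<close>, where the capacity is \<open>real m * s * y\<close>.\<close>

lemma sum_q_le_late:
  assumes A: "A \<subseteq> {..<n}" and "0 \<le> y" and comp: "\<And>j. j < n \<Longrightarrow> completes m s r p \<sigma> j"
  shows "(\<Sum>j\<in>A. q j t) \<le> real m * s * y + (\<Sum>j | j \<in> A \<and> t + y < C j. q j t)"
proof -
  let ?J = "{j. j \<in> A \<and> t + y < C j}"
  have fin: "finite A" using A finite_subset by blast
  have "(\<Sum>j\<in>A - ?J. q j t) = (\<Sum>j\<in>A - ?J. q j t - q j (t + y))"
  proof (rule sum.cong)
    fix j assume j: "j \<in> A - ?J"
    then have "j < n" using A by auto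
    then show "q j t = q j t - q j (t + y)"
      using completion_time(2)[OF _ comp, of j "t + y"] q_nonneg[of j "t + y"] j by auto
  qed simp
  also have "\<dots> \<le> real m * s * (t + y - t)"
    using A \<open>0 \<le> y\<close> by (intro sum_q_diff_le) auto
  finally have "(\<Sum>j\<in>A - ?J. q j t) \<le> real m * s * y" by simp
  moreover have "(\<Sum>j\<in>A. q j t) = (\<Sum>j\<in>A - ?J. q j t) + (\<Sum>j\<in>?J. q j t)"
    using fin by (intro sum.subset_diff) auto
  ultimately show ?thesis by simp
qed

end

section \<open>Order and volume under SRPT\<close>

locale srpt = sched +
  assumes m_pos: "1 \<le> m" and srpt: "srpt_schedule n m s r p \<sigma>"
begin

abbreviation "alv \<equiv> alive n m s r p \<sigma>"
abbreviation "small x t \<equiv> {j. j < n \<and> r j \<le> t \<and> 0 < q j t \<and> q j t < x}"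

lemma srpt_order: "i \<in> processed m \<sigma> t \<Longrightarrow> j \<in> alv t \<Longrightarrow> j \<notin> processed m \<sigma> t \<Longrightarrow> q i t \<le> q j t"
  using srpt by (auto simp: srpt_schedule_def)

lemma processed_subset_alive: "processed m \<sigma> t \<subseteq> alv t"
  using valid by (auto simp: valid_schedule_def)

lemma card_processed: "card (processed m \<sigma> t) = min m (card (alv t))"
  using srpt by (auto simp: srpt_schedule_def)

lemma card_processed_unprocessed:
  assumes "j \<in> alv t" "j \<notin> processed m \<sigma> t"
  shows "card (processed m \<sigma> t) = m"
proof -
  have "card (processed m \<sigma> t) < card (alv t)"
    using assms processed_subset_alive by (intro psubset_card_mono finite_alive) auto
  then show ?thesis using card_processed[of t] by simp
qed

lemma obtain_unprocessed:
  assumes "D \<subseteq> alv t" "m < card D"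
  obtains l where "l \<in> D" "l \<notin> processed m \<sigma> t"
proof -
  have "\<not> D \<subseteq> processed m \<sigma> t"
    using card_mono[OF finite_processed, of D t] card_processed_le[of t] assms by linarith
  then show ?thesis using that by auto
qed

lemma finite_small: "finite (small x t)"
  by (rule finite_subset[of _ "{..<n}"]) auto

text \<open>Processing a job that is not small would force all small jobs, at least \<open>m\<close>
  of them, to be processed as well, which exceeds the number of machines.\<close>

lemma small_processed:
  assumes "m \<le> card (small x t)"
  shows "processed m \<sigma> t \<subseteq> small x t" "card (processed m \<sigma> t) = m"
proof -
  have sub: "small x t \<subseteq> alv t" by (auto simp: alive_iff)
  have "m \<le> card (alv t)"
    using card_mono[OF finite_alive sub] assms by simp
  then show full: "card (processed m \<sigma> t) = m"
    by (simp add: card_processed)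
  show "processed m \<sigma> t \<subseteq> small x t"
  proof
    fix i assume i: "i \<in> processed m \<sigma> t"
    show "i \<in> small x t"
    proof (rule ccontr)
      assume ni: "i \<notin> small x t"
      then have "x \<le> q i t" using P_alive[OF i] by auto
      then have "small x t \<subseteq> processed m \<sigma> t"
        using srpt_order[OF i] sub by fastforce
      then have "card (insert i (small x t)) \<le> card (processed m \<sigma> t)"
        using i by (intro card_mono finite_processed) auto
      moreover have "card (insert i (small x t)) = Suc (card (small x t))"
        using ni finite_small by (intro card_insert_disjoint) auto
      ultimately show False using assms full by linarith
    qed
  qed
qed

section \<open>Persistence of the SRPT order and partially processed jobs\<close>

text \<open>Up to the first time \<open>z\<close> at which \<open>l\<close> would catch up,
  \<open>j\<close> is alive and strictly smaller, so SRPT runs \<open>j\<close> whenever it runs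
  \<open>l\<close>. Hence the gap cannot have closed at \<open>z\<close>.\<close>

lemma strict_order_preserved:
  assumes j: "j < n" and l: "l < n" and "r j \<le> v" "v \<le> u" "q j v < q l v" "0 < q j u"
  shows "q j u < q l u"
proof (rule ccontr)
  assume neg: "\<not> q j u < q l u"
  let ?Z = "{w \<in> {v..u}. q l w \<le> q j w}"
  define z where "z = Inf ?Z"
  have "closed ?Z"
    using q_continuous[OF j] q_continuous[OF l]
    by (intro continuous_on_closed_Collect_le) auto
  moreover have "u \<in> ?Z" using neg assms by auto
  moreover have bdd: "bdd_below ?Z" by (rule bdd_belowI[of _ v]) auto
  ultimately have "z \<in> ?Z"
    unfolding z_def by (intro closed_contains_Inf) auto
  have "q l v - q l z \<le> q j v - q j z"
  proof (rule q_diff_mono[OF j l])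
    fix w assume w: "v < w" "w < z" "l \<in> processed m \<sigma> w"
    have "w \<notin> ?Z"
      using w(2) cInf_lower[OF _ bdd] unfolding z_def by force
    then have "q j w < q l w" using w \<open>z \<in> ?Z\<close> by auto
    moreover have "j \<in> alv w"
      using assms w \<open>z \<in> ?Z\<close> q_mono[OF j, of w u] by (auto simp: alive_iff)
    ultimately show "j \<in> processed m \<sigma> w"
      using srpt_order[OF w(3)] by force
  qed (use \<open>z \<in> ?Z\<close> in auto)
  then show False using \<open>z \<in> ?Z\<close> assms by auto
qed

text \<open>
  The job \<open>j\<close> of \<open>D\<close> with the most remaining work at time \<open>b\<close> has the most throughout \<open>[a, b]\<close>. One of
  the more than \<open>m\<close> jobs is always waiting, so \<open>j\<close> can only be processed while tied with a waiting
  job, which happens on a null set. This is what excludes that the jobs of \<open>D\<close> shrink together by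
  sharing the machines.
\<close>

lemma no_entry_among_many:
  assumes D: "D \<subseteq> {..<n}" and card: "m < card D" and "a < b"
    and r: "\<And>j. j \<in> D \<Longrightarrow> r j \<le> a"
    and qb: "\<And>j. j \<in> D \<Longrightarrow> 0 < q j b \<and> q j b < x"
    and "j0 \<in> D" and j0: "x \<le> q j0 a"
  shows False
proof -
  have fin: "finite D" using D finite_subset by blast
  have "Max ((\<lambda>l. q l b) ` D) \<in> (\<lambda>l. q l b) ` D"
    using fin \<open>j0 \<in> D\<close> by (intro Max_in) auto
  then obtain j where j: "j \<in> D" and "q j b = Max ((\<lambda>l. q l b) ` D)" by auto
  then have max: "q l b \<le> q j b" if "l \<in> D" for l
    using that fin by auto
  have jn: "j < n" using D j by auto
  have ord: "q l w \<le> q j w" if "l \<in> D" "a \<le> w" "w \<le> b" for l w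
    using strict_order_preserved[of j l w b] that max[of l] qb[OF j] r[OF j] D jn
    by (force simp: not_less)
  have alv: "D \<subseteq> alv w" if "a \<le> w" "w \<le> b" for w
    using that r qb D q_mono[of _ w b] by (fastforce simp: alive_iff)
  define Z where "Z l = {w \<in> {a<..b}. w \<in> P j \<and> w \<notin> P l \<and> q j w = q l w}" for l
  have "negligible (Z l)" if l: "l \<in> D" for l
  proof (cases "\<exists>w \<in> {a..b}. q j w = q l w")
    case True
    have ln: "l < n" using D l by auto
    let ?E = "{w \<in> {a..b}. q j w = q l w}"
    \<comment> \<open>The last tie in the interval. Once \<open>l\<close> is strictly below
      \<open>j\<close> it stays there, so the ties fill all of \<open>[a, z]\<close>, and there both
      jobs are processed at almost the same times.\<close>
    define z where "z = Sup ?E"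
    have "closed ?E"
      using closed_Int[OF closed_atLeastAtMost closed_Collect_eq[OF q_continuous[OF jn] q_continuous[OF ln]]]
      by (simp add: Int_def)
    moreover have bdd: "bdd_above ?E" by (rule bdd_aboveI[of _ b]) auto
    ultimately have "z \<in> ?E"
      unfolding z_def using True by (intro closed_contains_Sup) auto
    have "q j w = q l w" if "a \<le> w" "w \<le> z" for w
    proof (rule ccontr)
      assume "q j w \<noteq> q l w"
      then have "q l w < q j w" using ord[OF l, of w] that \<open>z \<in> ?E\<close> by auto
      moreover have "0 < q l z"
        using q_mono[OF ln, of z b] qb[OF l] \<open>z \<in> ?E\<close> by auto
      ultimately have "q l z < q j z"
        using strict_order_preserved[OF ln jn, of w z] that r[OF l] by auto
      then show False using \<open>z \<in> ?E\<close> by auto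
    qed
    then have "negligible ((P j - P l) \<inter> {a<..z})"
      by (intro same_q_imp_same_processing jn ln) auto
    moreover have "Z l \<subseteq> (P j - P l) \<inter> {a<..z}"
      using cSup_upper[OF _ bdd] by (auto simp: Z_def z_def)
    ultimately show ?thesis using negligible_subset by blast
  next
    case False
    then have "Z l = {}" by (auto simp: Z_def)
    then show ?thesis by simp
  qed
  then have "negligible (\<Union>l\<in>D. Z l)"
    using fin by (intro negligible_Union) auto
  moreover have "P j \<inter> {a<..b} \<subseteq> (\<Union>l\<in>D. Z l)"
  proof
    fix w assume w: "w \<in> P j \<inter> {a<..b}"
    then obtain l where l: "l \<in> D" "l \<notin> processed m \<sigma> w"
      using obtain_unprocessed[OF alv card, of w] by auto
    then have "q j w \<le> q l w"
      using srpt_order[of j w l] alv[of w] w by auto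
    then show "w \<in> (\<Union>l\<in>D. Z l)"
      using ord[of l w] l w by (auto simp: Z_def)
  qed
  ultimately have "negligible (P j \<inter> {a<..b})"
    using negligible_subset by blast
  then have "q j a = q j b"
    using q_diff[OF jn, of a b] \<open>a < b\<close> by (simp add: negligible_imp_measure0)
  \<comment> \<open>The chain is \<open>x \<le> q j0 a \<le> q j a = q j b < x\<close>.\<close>
  then show False
    using ord[OF \<open>j0 \<in> D\<close>, of a] j0 qb[OF j] \<open>a < b\<close> by auto
qed

text \<open>Otherwise \<open>no_entry_among_many\<close> applies from the last release among these
  jobs: all of them are present then, and the job just released still has its full size, at least
  \<open>x\<close>.\<close>

lemma card_partial_le: "card {i. i < n \<and> r i \<le> t \<and> x \<le> p i \<and> 0 < q i t \<and> q i t < x} \<le> m"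
proof (rule ccontr)
  let ?D = "{i. i < n \<and> r i \<le> t \<and> x \<le> p i \<and> 0 < q i t \<and> q i t < x}"
  assume card: "\<not> card ?D \<le> m"
  have fin: "finite ?D" by (rule finite_subset[of _ "{..<n}"]) auto
  have "?D \<noteq> {}" using card by (metis card.empty zero_le)
  then have "Max (r ` ?D) \<in> r ` ?D" using fin by (intro Max_in) auto
  then obtain j0 where j0: "j0 \<in> ?D" and a: "r j0 = Max (r ` ?D)" by auto
  have max: "r j \<le> r j0" if "j \<in> ?D" for j
    using that fin a by (auto intro: Max_ge)
  have "r j0 \<noteq> t" using j0 q_before[of "r j0" j0] by auto
  show False
  proof (rule no_entry_among_many[of ?D "r j0" t x j0])
    show "x \<le> q j0 (r j0)" using j0 q_before[of "r j0" j0] by auto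
  qed (use card j0 max \<open>r j0 \<noteq> t\<close> in auto)
qed

text \<open>At the last time \<open>c'\<close> with at least \<open>x\<close> left, \<open>j\<close>
  and the small jobs are more than \<open>m\<close> in number. Shortly afterwards all of them are
  alive and below \<open>x\<close>, against \<open>no_entry_among_many\<close>.\<close>

lemma no_entry_while_busy:
  assumes j: "j < n" and "r j \<le> c" "c \<le> v" "x \<le> q j c"
    and busy: "\<And>u. c \<le> u \<Longrightarrow> u \<le> v \<Longrightarrow> m \<le> card (small x u)"
  shows "x \<le> q j v"
proof (rule ccontr)
  assume neg: "\<not> x \<le> q j v"
  let ?E = "{u \<in> {c..v}. x \<le> q j u}"
  define c' where "c' = Sup ?E"
  have "closed ?E"
    using q_continuous[OF j] by (intro continuous_on_closed_Collect_le) auto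
  moreover have bdd: "bdd_above ?E" by (rule bdd_aboveI[of _ v]) auto
  moreover have "c \<in> ?E" using assms by auto
  ultimately have c': "c' \<in> ?E"
    unfolding c'_def by (intro closed_contains_Sup) auto
  have "c' < v" using c' neg by (cases "c' = v") auto
  let ?D = "insert j (small x c')"
  have fin: "finite ?D" using finite_small by simp
  have "m \<le> card (small x c')" using busy c' by auto
  moreover have "j \<notin> small x c'" using c' by auto
  ultimately have card: "m < card ?D"
    using finite_small by (simp add: card_insert_disjoint)
  have "small x c' \<noteq> {}"
    using \<open>m \<le> card (small x c')\<close> m_pos by (metis card.empty not_one_le_zero order_trans)
  then have "0 < x" by auto
  have pos: "0 < q l c'" "l < n" if "l \<in> ?D" for l
    using that c' \<open>0 < x\<close> j by auto
  \<comment> \<open>By continuity, no job of \<open>?D\<close> completes immediately after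
    \<open>c'\<close>; this provides the right end \<open>b\<close>.\<close>
  have "eventually (\<lambda>u. \<forall>l\<in>?D. 0 < q l u) (at_right c')"
  proof (rule eventually_ball_finite[OF fin], rule)
    fix l assume "l \<in> ?D"
    then have "(q l \<longlongrightarrow> q l c') (at_right c')"
      by (rule q_tendsto[OF pos(2)])
    then show "eventually (\<lambda>u. 0 < q l u) (at_right c')"
      using pos(1)[OF \<open>l \<in> ?D\<close>] by (rule order_tendstoD)
  qed
  moreover have "eventually (\<lambda>u. u \<in> {c'<..<v}) (at_right c')"
    using \<open>c' < v\<close> by (rule eventually_at_right_real)
  ultimately have "\<exists>u. (\<forall>l\<in>?D. 0 < q l u) \<and> u \<in> {c'<..<v}"
    by (intro eventually_happens'[OF trivial_limit_at_right_real eventually_conj])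
  then obtain b where "\<forall>l\<in>?D. 0 < q l b" and b': "c' < b" "b < v"
    by auto
  then have b: "\<And>l. l \<in> ?D \<Longrightarrow> 0 < q l b" "c' < b" "b < v"
    by blast+
  have "b \<notin> ?E" using cSup_upper[OF _ bdd, of b] b unfolding c'_def by force
  then have "q j b < x" using b c' by auto
  show False
  proof (rule no_entry_among_many[of ?D c' b x j])
    show "0 < q l b \<and> q l b < x" if "l \<in> ?D" for l
      using that b \<open>q j b < x\<close> q_mono[of l c' b] by force
    show "r l \<le> c'" if "l \<in> ?D" for l
      using that assms c' by auto
  qed (use card c' b j in auto)
qed

section \<open>Volume of the small jobs\<close>

lemma sum_work_ge:
  assumes Q: "Q \<in> lmeasurable"
    and c: "\<And>v. v \<in> Q \<Longrightarrow> c \<le> card (processed m \<sigma> v)"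
  shows "real c * (s * \<mu> Q) \<le> (\<Sum>j<n. s * \<mu> (P j \<inter> Q))"
proof -
  have "real c * \<mu> Q \<le> (\<Sum>j<n. \<mu> (P j \<inter> Q))"
  proof (rule card_le_sum_measure(1))
    fix v assume "v \<in> Q"
    moreover have "processed m \<sigma> v = {j \<in> {..<n}. v \<in> P j}"
      using P_alive(1) by auto
    ultimately show "c \<le> card {j \<in> {..<n}. v \<in> P j}"
      using c[of v] by simp
  qed (use Q P_sets in auto)
  then have "s * (real c * \<mu> Q) \<le> s * (\<Sum>j<n. \<mu> (P j \<inter> Q))"
    using s_pos by (intro mult_left_mono) auto
  then show ?thesis by (simp add: sum_distrib_left mult_ac)
qed

lemma sum_q_diff_ge_Ioc:
  assumes "a \<le> b" and c: "\<And>v. a < v \<Longrightarrow> v \<le> b \<Longrightarrow> c \<le> card (processed m \<sigma> v)"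
  shows "real c * (s * (b - a)) \<le> (\<Sum>j<n. q j a - q j b)"
proof -
  have "(\<Sum>j<n. q j a - q j b) = (\<Sum>j<n. s * \<mu> (P j \<inter> {a<..b}))"
    using q_diff[OF _ assms(1)] by (intro sum.cong) auto
  then show ?thesis
    using sum_work_ge[of "{a<..b}" c] assms Ioc_lmeasurable by simp
qed

text \<open>
  \<open>T\<close> is the last time before \<open>t\<close> with fewer than \<open>m\<close> small jobs, as a supremum that need not be
  attained. Hence jobs may become small right after \<open>T\<close>, and \<open>no_entry_among_many\<close> is needed to see
  that the set \<open>D\<close> of small jobs that are not small arrivals still has at most \<open>m\<close> members.
\<close>

lemma small_volume_le:
  assumes x: "0 < x"
  obtains T where "T \<le> t"
    "(\<Sum>j\<in>small x t. q j t) + real m * (s * (t - T)) \<le>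
      real m * x + (\<Sum>j | j < n \<and> T \<le> r j \<and> r j \<le> t \<and> p j < x. p j)"
proof -
  define U where "U = {u. u \<le> t \<and> card (small x u) < m}"
  define T where "T = Sup U"
  \<comment> \<open>A time before \<open>t\<close> and before every release, when no job is alive.
    It shows that \<open>U\<close> is nonempty.\<close>
  define u0 where "u0 = Min (insert t (r ` {..<n})) - 1"
  have u0: "u0 < y" if "y \<in> insert t (r ` {..<n})" for y
    using Min_le[OF _ that] by (simp add: u0_def)
  have "u0 < r j" if "j < n" for j
    using that by (intro u0) auto
  then have "small x u0 = {}" by (auto simp: not_le)
  then have "card (small x u0) < m" using m_pos by (simp only: card.empty)
  moreover have "u0 \<le> t" using u0[of t] by simp
  ultimately have ne: "U \<noteq> {}" unfolding U_def by blast
  have bdd: "bdd_above U" by (rule bdd_aboveI[of _ t]) (auto simp: U_def)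
  have Tt: "T \<le> t" unfolding T_def using ne by (intro cSup_least) (auto simp: U_def)
  have busy: "m \<le> card (small x u)" if "T < u" "u \<le> t" for u
    using cSup_upper[OF _ bdd, of u] that by (force simp: T_def U_def)
  define B where "B = {j. j < n \<and> r j < T \<and> 0 < q j T \<and> q j T < x}"
  have finB: "finite B" by (rule finite_subset[of _ "{..<n}"]) (auto simp: B_def)
  \<comment> \<open>By continuity the jobs of \<open>B\<close> are already released and small at
    some time of \<open>U\<close> close to \<open>T\<close>. This is why \<open>B\<close> asks for
    release strictly before \<open>T\<close>.\<close>
  have cardB: "card B < m"
  proof -
    have "eventually (\<lambda>u. \<forall>j\<in>B. r j < u \<and> q j u < x) (nhds T)"
    proof (rule eventually_ball_finite[OF finB], rule, rule eventually_conj)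
      fix j assume j: "j \<in> B"
      show "eventually (\<lambda>u. r j < u) (nhds T)"
        using j by (intro eventually_nhds_in_open[of "{r j<..}", simplified]) (auto simp: B_def)
      have "(q j \<longlongrightarrow> q j T) (nhds T)"
        using q_isCont[of j T] j by (simp add: B_def isCont_def tendsto_at_iff_tendsto_nhds)
      then show "eventually (\<lambda>u. q j u < x) (nhds T)"
        using j by (auto simp: B_def dest: order_tendstoD)
    qed
    then obtain d where d: "d > 0" "\<And>u. dist u T < d \<Longrightarrow> \<forall>j\<in>B. r j < u \<and> q j u < x"
      by (auto simp: eventually_nhds_metric)
    obtain u where u: "u \<in> U" "T - d < u"
      using less_cSupD[OF ne, of "T - d"] d(1) by (auto simp: T_def)
    have "u \<le> T" unfolding T_def using u bdd by (intro cSup_upper)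
    then have "B \<subseteq> small x u"
      using d(2)[of u] u q_mono[of _ u T] by (fastforce simp: B_def dist_real_def)
    then have "card B \<le> card (small x u)"
      by (intro card_mono finite_small)
    then show ?thesis using u by (simp add: U_def)
  qed
  \<comment> \<open>For \<open>T = t\<close> the interval \<open>{T<..t}\<close> is empty, but the
    jobs small at \<open>t\<close> must still be counted.\<close>
  define V where "V = (if T < t then {T<..t} else {t})"
  have VT: "T \<le> v" "v \<le> t" if "v \<in> V" for v
    using that Tt by (auto simp: V_def split: if_splits)
  have tV: "t \<in> V" by (auto simp: V_def)
  let ?N = "{j. j < n \<and> T \<le> r j \<and> r j \<le> t \<and> p j < x}"
  define D where "D = {j. j < n \<and> \<not> (T \<le> r j \<and> p j < x) \<and> (\<exists>v\<in>V. j \<in> small x v)}"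
  have Dn: "D \<subseteq> {..<n}" by (auto simp: D_def)
  have finD: "finite D" by (rule finite_subset[of _ "{..<n}"]) (auto simp: D_def)
  have D: "card D \<le> m \<and> (\<forall>j\<in>D. q j T \<le> x)"
  proof (cases "T < t")
    case False
    then have V: "V = {T}" "T = t" using Tt by (auto simp: V_def)
    have "D \<subseteq> B"
    proof
      fix j assume j: "j \<in> D"
      then have "r j \<noteq> T" using q_before[of T j] by (auto simp: D_def V)
      then show "j \<in> B" using j by (auto simp: D_def V B_def)
    qed
    then have "card D \<le> m" using card_mono[OF finB \<open>D \<subseteq> B\<close>] cardB by linarith
    moreover have "\<forall>j\<in>D. q j T \<le> x" using \<open>D \<subseteq> B\<close> by (auto simp: B_def)
    ultimately show ?thesis by blast
  next
    case True
    have "\<forall>j\<in>D. \<exists>v. T < v \<and> v \<le> t \<and> j \<in> small x v"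
      using True by (auto simp: D_def V_def)
    from bchoice[OF this] obtain w where "\<forall>j\<in>D. T < w j \<and> w j \<le> t \<and> j \<in> small x (w j)"
      by (rule exE)
    then have w: "T < w j" "w j \<le> t" "j \<in> small x (w j)" if "j \<in> D" for j
      using that by simp_all
    \<comment> \<open>Members of \<open>D\<close> released after \<open>T\<close> would have size at
      least \<open>x\<close>, and after \<open>T\<close> the machines are too busy with small jobs
      for them to become small.\<close>
    have rD: "r j \<le> T" if j: "j \<in> D" for j
    proof (rule ccontr)
      assume "\<not> r j \<le> T"
      then have "x \<le> q j (r j)" using j q_before[of "r j" j] by (auto simp: D_def)
      have "x \<le> q j (w j)"
      proof (rule no_entry_while_busy)
        show "m \<le> card (small x u)" if "r j \<le> u" "u \<le> w j" for u
          using that \<open>\<not> r j \<le> T\<close> w(2)[OF j] by (intro busy) auto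
      qed (use w(3)[OF j] \<open>x \<le> q j (r j)\<close> in auto)
      then show False using w(3)[OF j] by auto
    qed
    have below: "q j u < x" if j: "j \<in> D" and u: "T < u" "u \<le> w j" for j u
    proof (rule ccontr)
      assume "\<not> q j u < x"
      have "x \<le> q j (w j)"
      proof (rule no_entry_while_busy)
        show "m \<le> card (small x v)" if "u \<le> v" "v \<le> w j" for v
          using that u(1) w(2)[OF j] by (intro busy) auto
        show "x \<le> q j u" using \<open>\<not> q j u < x\<close> by simp
      qed (use w(3)[OF j] rD[OF j] u in auto)
      then show False using w(3)[OF j] by auto
    qed
    have qT: "q j T \<le> x" if j: "j \<in> D" for j
    proof (rule tendsto_upperbound)
      show "(q j \<longlongrightarrow> q j T) (at_right T)"
        using j by (intro q_tendsto) (auto simp: D_def)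
      show "eventually (\<lambda>u. q j u \<le> x) (at_right T)"
        using eventually_at_right_real[OF w(1)[OF j]]
        by eventually_elim (use below[OF j] in \<open>auto intro: less_imp_le\<close>)
    qed simp
    have "card D \<le> m"
    proof (rule ccontr)
      assume card: "\<not> card D \<le> m"
      then have neD: "D \<noteq> {}" by auto
      define b where "b = Min (w ` D)"
      have b: "b \<le> w j" if "j \<in> D" for j
        unfolding b_def using finD that by auto
      have Tb: "T < b"
        unfolding b_def using finD neD w(1) by (subst Min_gr_iff) auto
      \<comment> \<open>Since \<open>B\<close> has fewer than \<open>m\<close> members, not all of
        \<open>D\<close> can be below \<open>x\<close> at \<open>T\<close>. By the time
        \<open>b\<close> all of \<open>D\<close> is below \<open>x\<close>, which
        \<open>no_entry_among_many\<close> forbids.\<close>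
      have "\<exists>j0\<in>D. x \<le> q j0 T"
      proof (rule ccontr)
        assume no: "\<not> (\<exists>j0\<in>D. x \<le> q j0 T)"
        have "D \<subseteq> B"
        proof
          fix j assume j: "j \<in> D"
          have "r j \<noteq> T" using no j q_before[of T j] by (auto simp: D_def)
          moreover have "0 < q j T"
            using q_mono[of j T "w j"] w[OF j] by auto
          ultimately show "j \<in> B" using j rD[OF j] no by (force simp: B_def D_def)
        qed
        then show False using card_mono[OF finB \<open>D \<subseteq> B\<close>] cardB card by linarith
      qed
      then obtain j0 where j0: "j0 \<in> D" "x \<le> q j0 T" by auto
      show False
      proof (rule no_entry_among_many[of D T b x j0])
        fix j assume j: "j \<in> D"
        show "0 < q j b \<and> q j b < x"
          using below[OF j Tb b[OF j]] q_mono[OF _ b[OF j], of j] w(3)[OF j] by auto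
      qed (use card Tb rD j0 in \<open>auto simp: D_def\<close>)
    qed
    then show ?thesis using qT by auto
  qed
  \<comment> \<open>The contribution of \<open>j\<close> to the left-hand side: its small volume at
    \<open>t\<close> plus the work done on it since \<open>T\<close>. It is at most
    \<open>q j T\<close>, hence at most \<open>x\<close> on \<open>D\<close> and at most
    \<open>p j\<close> on small arrivals. It vanishes for other jobs, because only small jobs run
    between \<open>T\<close> and \<open>t\<close>.\<close>
  define f where "f j = (if j \<in> small x t then q j t else 0) + (q j T - q j t)" for j
  have f: "f j \<le> (if j \<in> D then x else 0) + (if j \<in> ?N then p j else 0)" if j: "j < n" for j
  proof -
    have fle: "f j \<le> q j T" using q_nonneg[OF j] by (auto simp: f_def)
    consider "j \<in> D" | "j \<in> ?N" | "j \<notin> D" "j \<notin> ?N" by blast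
    then show ?thesis
    proof cases
      case 1
      then show ?thesis using fle D p_pos[OF j] by force
    next
      case 2
      then show ?thesis using fle q_le_p[OF j, of T] x by auto
    next
      case 3
      have nosmall: "j \<notin> small x v" if "v \<in> V" for v
        using 3 that j VT[OF that] unfolding D_def by fastforce
      have "q j t = q j T"
      proof (rule not_processed_imp_q_eq[OF j Tt])
        fix v assume v: "T < v" "v < t"
        then show "j \<notin> processed m \<sigma> v"
          using small_processed(1)[OF busy, of v] nosmall[of v] by (auto simp: V_def)
      qed
      then have "f j = 0" unfolding f_def if_not_P[OF nosmall[OF tV]] by simp
      then show ?thesis unfolding if_not_P[OF 3(1)] if_not_P[OF 3(2)] by simp
    qed
  qed
  have "(\<Sum>j\<in>small x t. q j t) = (\<Sum>j<n. if j \<in> small x t then q j t else 0)"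
    by (subst sum.inter_restrict[symmetric]) (auto intro!: sum.cong)
  moreover have "real m * (s * (t - T)) \<le> (\<Sum>j<n. q j T - q j t)"
    using small_processed(2)[OF busy] by (intro sum_q_diff_ge_Ioc Tt) auto
  ultimately have "(\<Sum>j\<in>small x t. q j t) + real m * (s * (t - T)) \<le> (\<Sum>j<n. f j)"
    by (simp add: f_def sum.distrib)
  also have "\<dots> \<le> (\<Sum>j<n. (if j \<in> D then x else 0) + (if j \<in> ?N then p j else 0))"
    using f by (intro sum_mono) auto
  also have "\<dots> = (\<Sum>j<n. if j \<in> D then x else 0) + (\<Sum>j<n. if j \<in> ?N then p j else 0)"
    by (rule sum.distrib)
  also have "(\<Sum>j<n. if j \<in> D then x else 0) = (\<Sum>j\<in>D. x)"
    using sum.inter_restrict[of "{..<n}" "\<lambda>_. x" D] Dn by (simp add: Int_absorb1)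
  also have "(\<Sum>j<n. if j \<in> ?N then p j else 0) = (\<Sum>j\<in>?N. p j)"
    by (subst sum.inter_restrict[symmetric]) (auto intro!: sum.cong)
  also have "(\<Sum>j\<in>D. x) \<le> real m * x"
    using D x by (simp add: mult_right_mono)
  finally show ?thesis using that Tt by simp
qed

section \<open>Completion, flow time and number of completions\<close>

text \<open>An unfinished job keeps at least one machine busy, so by the time \<open>b\<close> more
  work would have been done than the total size of all jobs.\<close>

lemma all_complete:
  assumes i: "i < n"
  shows "completes m s r p \<sigma> i"
proof (rule ccontr)
  assume "\<not> completes m s r p \<sigma> i"
  then have pos: "0 < q i t" for t
    by (force simp: completes_def remaining_def not_le)
  define b where "b = r i + ((\<Sum>j<n. p j) + 1) / s"
  have nn: "0 \<le> (\<Sum>j<n. p j)" using p_pos by (intro sum_nonneg) (auto intro: less_imp_le)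
  then have rb: "r i \<le> b" using s_pos by (simp add: b_def)
  have "real 1 * (s * (b - r i)) \<le> (\<Sum>j<n. q j (r i) - q j b)"
  proof (rule sum_q_diff_ge_Ioc[OF rb])
    fix v assume "r i < v"
    then have "i \<in> alv v" using i pos by (simp add: alive_iff)
    then have "card (alv v) \<noteq> 0" using finite_alive by auto
    then show "1 \<le> card (processed m \<sigma> v)" using m_pos by (simp add: card_processed)
  qed
  also have "\<dots> \<le> (\<Sum>j<n. p j)"
  proof (rule sum_mono)
    fix j assume "j \<in> {..<n}"
    then show "q j (r i) - q j b \<le> p j"
      using q_nonneg[of j b] q_le_p[of j "r i"] by auto
  qed
  finally show False using s_pos by (simp add: b_def)
qed

text \<open>While \<open>i\<close> waits, all machines work on jobs with no more remaining work than
  \<open>i\<close>. By \<open>strict_order_preserved\<close> such a job was no larger than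
  \<open>i\<close> already at the later of the two releases, so it is counted on the right. The term
  \<open>p i\<close> accounts for the time when \<open>i\<close> itself runs.\<close>

lemma flow_volume_le:
  assumes i: "i < n"
  shows "real m * (s * (C i - r i) - p i) \<le>
    (\<Sum>j | j < n \<and> r j \<le> r i \<and> q j (r i) \<le> p i. q j (r i)) +
    (\<Sum>j | j < n \<and> r i < r j \<and> r j < C i \<and> p j \<le> p i. p j)"
proof -
  note Ci = completion_time[OF i all_complete[OF i]]
  have rC: "r i \<le> C i"
    using Ci(2)[of "r i"] q_before[of "r i" i] p_pos[OF i] by auto
  have qC: "q i (C i) = 0" using Ci(2)[of "C i"] q_nonneg[OF i, of "C i"] by auto
  define Q where "Q = {r i<..<C i} - P i"
  have opn: "{r i<..<C i} \<in> lmeasurable" by simp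
  have PI: "P i \<inter> {r i<..C i} = P i \<inter> {r i<..<C i}"
    using P_alive(3)[of i "C i"] qC by (force simp: le_less)
  have PI_lm: "P i \<inter> {r i<..<C i} \<in> lmeasurable"
    using P_Ioc_lmeasurable[OF i, of "r i" "C i"] by (simp add: PI)
  have Q_eq: "Q = {r i<..<C i} - (P i \<inter> {r i<..<C i})" by (auto simp: Q_def)
  have Q: "Q \<in> lmeasurable" unfolding Q_eq using opn PI_lm by (rule fmeasurable.Diff)
  have "\<mu> Q = \<mu> {r i<..<C i} - \<mu> (P i \<inter> {r i<..<C i})"
    unfolding Q_eq using opn PI_lm by (intro measurable_measure_Diff) (auto intro: fmeasurableD)
  moreover have "s * \<mu> (P i \<inter> {r i<..<C i}) = p i"
    using q_diff[OF i rC] qC q_before[of "r i" i] by (simp add: PI)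
  ultimately have muQ: "s * \<mu> Q = s * (C i - r i) - p i"
    using rC by (simp add: right_diff_distrib)
  have aliveQ: "i \<in> alv v" "i \<notin> processed m \<sigma> v" if "v \<in> Q" for v
    using that Ci(2)[of v] i by (auto simp: alive_iff Q_def)
  let ?A = "{j. j < n \<and> r j \<le> r i \<and> q j (r i) \<le> p i}"
  let ?N = "{j. j < n \<and> r i < r j \<and> r j < C i \<and> p j \<le> p i}"
  have bound: "s * \<mu> (P j \<inter> Q) \<le> (if j \<in> ?A then q j (r i) else 0) + (if j \<in> ?N then p j else 0)"
    if j: "j < n" for j
  proof -
    have "\<mu> (P j \<inter> Q) \<le> \<mu> (P j \<inter> {r i<..C i})"
    proof (rule measure_mono_fmeasurable)
      show "P j \<inter> Q \<in> sets lebesgue" using Q P_sets[OF j] by (auto intro: fmeasurableD)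
    qed (use P_Ioc_lmeasurable[OF j] in \<open>auto simp: Q_def\<close>)
    then have "s * \<mu> (P j \<inter> Q) \<le> s * \<mu> (P j \<inter> {r i<..C i})"
      using s_pos by simp
    also have "\<dots> \<le> q j (r i)"
      using q_diff[OF j rC] q_nonneg[OF j, of "C i"] by simp
    finally have le: "s * \<mu> (P j \<inter> Q) \<le> q j (r i)" .
    show ?thesis
    proof (cases "P j \<inter> Q = {}")
      case True
      then show ?thesis using q_nonneg[OF j] p_pos[OF j] by (auto intro: less_imp_le)
    next
      case False
      then obtain v where v: "v \<in> Q" "j \<in> processed m \<sigma> v" by auto
      have "\<not> q i v < q j v"
        using srpt_order[OF v(2) aliveQ[OF v(1)]] by simp
      then have ord: "\<not> q i u < q j u" if "r i \<le> u" "u \<le> v" for u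
        using strict_order_preserved[OF i j, of u v] that aliveQ(1)[OF v(1)] by (auto simp: alive_iff)
      have rv: "r i \<le> v" "v < C i" "r j \<le> v"
        using v P_alive(2) by (auto simp: Q_def)
      show ?thesis
      proof (cases "r j \<le> r i")
        case True
        then have "q j (r i) \<le> p i"
          using ord[of "r i"] rv q_before[of "r i" i] by simp
        then show ?thesis using le True j by simp
      next
        case False
        then have "p j \<le> p i"
          using ord[of "r j"] rv q_before[of "r j" j] q_le_p[OF i, of "r j"] by simp
        then show ?thesis using le False j rv q_le_p[OF j, of "r i"] by simp
      qed
    qed
  qed
  have "real m * (s * \<mu> Q) \<le> (\<Sum>j<n. s * \<mu> (P j \<inter> Q))"
    using card_processed_unprocessed[OF aliveQ] Q
    by (intro sum_work_ge) auto
  also have "\<dots> \<le> (\<Sum>j<n. (if j \<in> ?A then q j (r i) else 0) + (if j \<in> ?N then p j else 0))"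
    using bound by (intro sum_mono) auto
  also have "\<dots> = (\<Sum>j<n. if j \<in> ?A then q j (r i) else 0) + (\<Sum>j<n. if j \<in> ?N then p j else 0)"
    by (rule sum.distrib)
  also have "(\<Sum>j<n. if j \<in> ?A then q j (r i) else 0) = (\<Sum>j\<in>?A. q j (r i))"
    by (subst sum.inter_restrict[symmetric]) (auto intro!: sum.cong)
  also have "(\<Sum>j<n. if j \<in> ?N then p j else 0) = (\<Sum>j\<in>?N. p j)"
    by (subst sum.inter_restrict[symmetric]) (auto intro!: sum.cong)
  finally show ?thesis by (simp add: muQ)
qed

text \<open>Apart from the at most \<open>m\<close> jobs of \<open>card_partial_le\<close>, each job
  counted has at least \<open>x\<close> units left at time \<open>a\<close>, all of which must be
  done by \<open>b\<close>.\<close>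

lemma card_completions_le:
  assumes "a \<le> b" and x: "0 < x"
  shows "x * card {i. i < n \<and> x \<le> p i \<and> a < C i \<and> C i \<le> b} \<le> real m * x + real m * s * (b - a)"
proof -
  let ?I = "{i. i < n \<and> x \<le> p i \<and> a < C i \<and> C i \<le> b}"
  let ?A = "{i. i < n \<and> r i \<le> a \<and> x \<le> p i \<and> 0 < q i a \<and> q i a < x}"
  have fin: "finite ?I" by (rule finite_subset[of _ "{..<n}"]) auto
  note Ci = completion_time(2)[OF _ all_complete]
  have "x * card (?I - ?A) = (\<Sum>i\<in>?I - ?A. x)" by simp
  also have "\<dots> \<le> (\<Sum>i\<in>?I - ?A. q i a - q i b)"
  proof (rule sum_mono)
    fix i assume i: "i \<in> ?I - ?A"
    then have "q i b = 0" "0 < q i a"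
      using Ci[of i b] Ci[of i a] q_nonneg[of i b] by auto
    moreover have "x \<le> q i a"
      using i \<open>0 < q i a\<close> q_before[of a i] by (cases "r i \<le> a") auto
    ultimately show "x \<le> q i a - q i b" by simp
  qed
  also have "\<dots> \<le> real m * s * (b - a)"
    using assms by (intro sum_q_diff_le) auto
  finally have 1: "x * card (?I - ?A) \<le> real m * s * (b - a)" .
  have "card ?I \<le> card (?I - ?A) + card ?A"
    by (rule order_trans[OF card_mono card_Un_le]) (use fin in auto)
  also have "\<dots> \<le> card (?I - ?A) + m"
    using card_partial_le by simp
  finally have "x * card ?I \<le> x * (card (?I - ?A) + real m)"
    using x by (simp flip: of_nat_add)
  then show ?thesis using 1 by (simp add: algebra_simps)
qed

end

section \<open>Charging to a unit speed schedule\<close>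

locale srpt_vs = S: srpt n m s r p \<sigma> + O: sched n m 1 r p \<tau>
  for n m s r p \<sigma> \<tau> +
  assumes s_ge: "1 \<le> s" and O_completes: "\<And>j. j < n \<Longrightarrow> completes m 1 r p \<tau> j"
begin

text \<open>On arrivals since \<open>T\<close> the competitor has done at most
  \<open>m * (t - T)\<close> units of work, which the term \<open>m * (s * (t - T))\<close> of
  \<open>small_volume_le\<close> pays for.\<close>

lemma small_volume_le_opt:
  assumes "0 < x"
  shows "(\<Sum>j\<in>S.small x t. S.q j t) \<le> real m * x + (\<Sum>j | j < n \<and> r j \<le> t \<and> p j < x. O.q j t)"
proof -
  obtain T where T: "T \<le> t" "(\<Sum>j\<in>S.small x t. S.q j t) + real m * (s * (t - T)) \<le>
      real m * x + (\<Sum>j | j < n \<and> T \<le> r j \<and> r j \<le> t \<and> p j < x. p j)"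
    using S.small_volume_le[OF assms] by blast
  let ?N = "{j. j < n \<and> T \<le> r j \<and> r j \<le> t \<and> p j < x}"
  have "(\<Sum>j\<in>?N. p j) = (\<Sum>j\<in>?N. O.q j T - O.q j t) + (\<Sum>j\<in>?N. O.q j t)"
    unfolding sum.distrib[symmetric] by (intro sum.cong) (auto simp: O.q_before)
  also have "(\<Sum>j\<in>?N. O.q j T - O.q j t) \<le> real m * 1 * (t - T)"
    using T(1) by (intro O.sum_q_diff_le) auto
  also have "(\<Sum>j\<in>?N. O.q j t) \<le> (\<Sum>j | j < n \<and> r j \<le> t \<and> p j < x. O.q j t)"
    using O.q_nonneg by (intro sum_mono2) auto
  also have "real m * 1 * (t - T) \<le> real m * (s * (t - T))"
    using s_ge T(1) mult_right_mono[OF s_ge, of "t - T"] by (simp add: mult_left_mono)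
  finally show ?thesis using T(2) by simp
qed

text \<open>The weak threshold is needed because \<open>flow_volume_le\<close> includes ties with
  \<open>p i\<close>. It is reached from strict thresholds \<open>y\<close> above \<open>x\<close>,
  at a cost of \<open>m * (y - x) < e\<close>.\<close>

lemma volume_le_opt:
  assumes x: "0 < x"
  shows "(\<Sum>j | j < n \<and> r j \<le> t \<and> S.q j t \<le> x. S.q j t) \<le>
    real m * x + (\<Sum>j | j < n \<and> r j \<le> t \<and> p j \<le> x. O.q j t)"
proof (rule field_le_epsilon)
  fix e :: real assume e: "0 < e"
  \<comment> \<open>finitely many sizes: a threshold slightly above \<open>x\<close> admits no further original sizes\<close>
  have "eventually (\<lambda>y. \<forall>j\<in>{..<n}. p j < y \<longrightarrow> p j \<le> x) (at_right x)"
  proof (rule eventually_ball_finite, simp, rule)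
    fix j
    show "eventually (\<lambda>y. p j < y \<longrightarrow> p j \<le> x) (at_right x)"
    proof (cases "p j \<le> x")
      case False
      then show ?thesis
        by (intro eventually_mono[OF eventually_at_right_real[of x "p j"]]) auto
    qed simp
  qed
  moreover have "eventually (\<lambda>y. y \<in> {x<..<x + e / m}) (at_right x)"
    using e S.m_pos by (intro eventually_at_right_real) simp
  ultimately have "\<exists>y. (\<forall>j\<in>{..<n}. p j < y \<longrightarrow> p j \<le> x) \<and> y \<in> {x<..<x + e / m}"
    by (intro eventually_happens'[OF trivial_limit_at_right_real eventually_conj])
  then obtain y where y: "\<And>j. j < n \<Longrightarrow> p j < y \<Longrightarrow> p j \<le> x" "x < y" "y < x + e / m"
    by auto
  have "(\<Sum>j | j < n \<and> r j \<le> t \<and> S.q j t \<le> x. S.q j t) =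
      (\<Sum>j | j < n \<and> r j \<le> t \<and> 0 < S.q j t \<and> S.q j t \<le> x. S.q j t)"
    using S.q_nonneg by (intro sum.mono_neutral_right) (auto simp: less_le)
  also have "\<dots> \<le> (\<Sum>j\<in>S.small y t. S.q j t)"
    using y(2) S.finite_small by (intro sum_mono2) auto
  also have "\<dots> \<le> real m * y + (\<Sum>j | j < n \<and> r j \<le> t \<and> p j < y. O.q j t)"
    using x y by (intro small_volume_le_opt) auto
  also have "{j. j < n \<and> r j \<le> t \<and> p j < y} = {j. j < n \<and> r j \<le> t \<and> p j \<le> x}"
    using y by force
  also have "real m * y \<le> real m * x + e"
    using y(3) S.m_pos by (simp add: field_simps)
  finally show "(\<Sum>j | j < n \<and> r j \<le> t \<and> S.q j t \<le> x. S.q j t) \<le>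
    real m * x + (\<Sum>j | j < n \<and> r j \<le> t \<and> p j \<le> x. O.q j t) + e" by simp
qed

section \<open>Charging the competitor's backlog\<close>

definition vol :: "nat \<Rightarrow> real" where
  "vol i = (\<Sum>j | j < n \<and> r j < S.C i \<and> p j \<le> p i. O.q j (S.C i))"

definition flow :: "nat \<Rightarrow> real" where
  "flow i = S.C i - r i"

definition oflow :: "nat \<Rightarrow> real" where
  "oflow j = O.C j - r j"

lemma vol_nonneg: "0 \<le> vol i"
  unfolding vol_def using O.q_nonneg by (intro sum_nonneg) auto

lemma flow_pos: "i < n \<Longrightarrow> 0 < flow i"
  using S.completion_time(2)[OF _ S.all_complete, of i "r i"] S.q_before[of "r i" i] S.p_pos[of i]
  by (auto simp: flow_def)

lemma p_le_oflow: "j < n \<Longrightarrow> p j \<le> oflow j"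
  using O.completion_time(1)[OF _ O_completes] by (simp add: oflow_def)

text \<open>Relevant work present at \<open>r i\<close> or arriving before completion is either done
  by the competitor, at most \<open>m * flow i\<close>, or left in \<open>vol i\<close>. One term
  \<open>m * p i\<close> comes from the processing of \<open>i\<close>, the other from
  \<open>volume_le_opt\<close>.\<close>

lemma flow_le_vol:
  assumes i: "i < n"
  shows "real m * (s - 1) * flow i \<le> 2 * real m * p i + vol i"
proof -
  have rC: "r i < S.C i" using flow_pos[OF i] by (simp add: flow_def)
  let ?A = "{j. j < n \<and> r j \<le> r i \<and> p j \<le> p i}"
  let ?N = "{j. j < n \<and> r i < r j \<and> r j < S.C i \<and> p j \<le> p i}"
  let ?W = "{j. j < n \<and> r j < S.C i \<and> p j \<le> p i}"
  have "real m * (s * flow i - p i) \<le>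
      (\<Sum>j | j < n \<and> r j \<le> r i \<and> S.q j (r i) \<le> p i. S.q j (r i)) + (\<Sum>j\<in>?N. p j)"
    using S.flow_volume_le[OF i] by (simp add: flow_def)
  also have "(\<Sum>j\<in>?N. p j) = (\<Sum>j\<in>?N. O.q j (r i))"
    by (intro sum.cong) (auto simp: O.q_before)
  also have "(\<Sum>j | j < n \<and> r j \<le> r i \<and> S.q j (r i) \<le> p i. S.q j (r i)) \<le>
      real m * p i + (\<Sum>j\<in>?A. O.q j (r i))"
    using S.p_pos[OF i] by (rule volume_le_opt)
  also have "real m * p i + (\<Sum>j\<in>?A. O.q j (r i)) + (\<Sum>j\<in>?N. O.q j (r i)) =
      real m * p i + (\<Sum>j\<in>?A \<union> ?N. O.q j (r i))"
    by (subst sum.union_disjoint) auto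
  also have "?A \<union> ?N = ?W" using rC by auto
  also have "(\<Sum>j\<in>?W. O.q j (r i)) = (\<Sum>j\<in>?W. O.q j (r i) - O.q j (S.C i)) + vol i"
    by (simp add: vol_def sum_subtractf)
  also have "(\<Sum>j\<in>?W. O.q j (r i) - O.q j (S.C i)) \<le> real m * 1 * flow i"
    unfolding flow_def using rC by (intro O.sum_q_diff_le) auto
  finally show ?thesis by (simp add: algebra_simps)
qed

abbreviation "charged i j \<equiv> p j \<le> p i \<and> r j < S.C i \<and> S.C i \<le> O.C j"

lemma vol_powr_le:
  assumes k: "1 \<le> k"
  shows "vol i powr k \<le> 2 * (2 * real m) powr (k - 1) *
    (\<Sum>j<n. if charged i j then p j * oflow j powr (k - 1) else 0)"
proof (cases "vol i = 0")
  case True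
  then show ?thesis using k S.p_pos
    by (auto intro!: mult_nonneg_nonneg sum_nonneg simp: less_imp_le)
next
  case False
  then have pos: "0 < vol i" using vol_nonneg[of i] by simp
  \<comment> \<open>With this delay, jobs the competitor finishes by \<open>S.C i + y\<close> hold
    at most half of \<open>vol i\<close>. The others have \<open>oflow j \<ge> y\<close>, which
    bounds the factor \<open>vol i powr (k - 1)\<close>.\<close>
  define y where "y = vol i / (2 * real m)"
  have m: "0 < real m" using S.m_pos by simp
  have y: "0 < y" using pos m by (simp add: y_def)
  let ?W = "{j. j < n \<and> r j < S.C i \<and> p j \<le> p i}"
  let ?J = "{j. j \<in> ?W \<and> S.C i + y < O.C j}"
  have "vol i \<le> real m * 1 * y + (\<Sum>j\<in>?J. O.q j (S.C i))"
    unfolding vol_def using y O_completes by (intro O.sum_q_le_late) auto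
  also have "real m * 1 * y = vol i / 2" using m by (simp add: y_def)
  also have "(\<Sum>j\<in>?J. O.q j (S.C i)) \<le> (\<Sum>j\<in>?J. p j)"
    by (intro sum_mono O.q_le_p) auto
  finally have half: "vol i \<le> 2 * (\<Sum>j\<in>?J. p j)" by simp
  have "vol i powr k = vol i * vol i powr (k - 1)"
    using pos by (simp add: powr_mult_base)
  also have "\<dots> \<le> 2 * (\<Sum>j\<in>?J. p j) * vol i powr (k - 1)"
    using half by (intro mult_right_mono) auto
  also have "\<dots> = 2 * (\<Sum>j\<in>?J. p j * vol i powr (k - 1))"
    by (simp add: sum_distrib_right)
  also have "(\<Sum>j\<in>?J. p j * vol i powr (k - 1)) \<le>
      (\<Sum>j\<in>?J. p j * ((2 * real m) powr (k - 1) * oflow j powr (k - 1)))"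
  proof (rule sum_mono)
    fix j assume j: "j \<in> ?J"
    then have "y \<le> oflow j" by (auto simp: oflow_def)
    then have "vol i \<le> 2 * real m * oflow j" using m by (simp add: y_def field_simps)
    then have "vol i powr (k - 1) \<le> (2 * real m * oflow j) powr (k - 1)"
      using pos k by (intro powr_mono2) auto
    also have "\<dots> = (2 * real m) powr (k - 1) * oflow j powr (k - 1)"
      by (rule powr_mult)
    finally show "p j * vol i powr (k - 1) \<le> p j * ((2 * real m) powr (k - 1) * oflow j powr (k - 1))"
      using j S.p_pos[of j] by (intro mult_left_mono) auto
  qed
  also have "\<dots> = (2 * real m) powr (k - 1) * (\<Sum>j\<in>?J. p j * oflow j powr (k - 1))"
    by (simp add: sum_distrib_left mult_ac)
  also have "(\<Sum>j\<in>?J. p j * oflow j powr (k - 1)) =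
      (\<Sum>j\<in>?J. if charged i j then p j * oflow j powr (k - 1) else 0)"
    using y by (intro sum.cong) auto
  also have "\<dots> \<le> (\<Sum>j<n. if charged i j then p j * oflow j powr (k - 1) else 0)"
    using S.p_pos by (intro sum_mono2) (auto simp: less_imp_le)
  finally show ?thesis by (simp add: mult_left_mono mult.assoc)
qed

text \<open>The additive \<open>m * p j\<close> of \<open>card_completions_le\<close> is absorbed
  using \<open>p j \<le> oflow j\<close>, valid at unit speed.\<close>

lemma charged_count_le:
  assumes j: "j < n"
  shows "p j * card {i. i < n \<and> charged i j} \<le> real m * (1 + s) * oflow j"
proof -
  have pf: "p j \<le> oflow j" "0 < p j" using p_le_oflow[OF j] S.p_pos[OF j] by auto
  have "{i. i < n \<and> charged i j} = {i. i < n \<and> p j \<le> p i \<and> r j < S.C i \<and> S.C i \<le> O.C j}"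
    by auto
  then have "p j * card {i. i < n \<and> charged i j} \<le> real m * p j + real m * s * oflow j"
    using S.card_completions_le[of "r j" "O.C j" "p j"] pf by (simp add: oflow_def)
  also have "\<dots> \<le> real m * oflow j + real m * s * oflow j"
    using pf by (simp add: mult_left_mono)
  finally show ?thesis by (simp add: algebra_simps)
qed

text \<open>Exchanging the sums, the weight \<open>p j\<close> times the number of charges to
  \<open>j\<close> supplies one factor \<open>oflow j\<close>, which restores the exponent
  \<open>k\<close>.\<close>

lemma sum_vol_powr_le:
  assumes k: "1 \<le> k"
  shows "(\<Sum>i<n. vol i powr k) \<le> (1 + s) * (2 * real m) powr k * (\<Sum>j<n. oflow j powr k)"
proof -
  let ?c = "2 * (2 * real m) powr (k - 1)"
  have "(\<Sum>i<n. vol i powr k) \<le>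
      (\<Sum>i<n. ?c * (\<Sum>j<n. if charged i j then p j * oflow j powr (k - 1) else 0))"
    using vol_powr_le[OF k] by (intro sum_mono)
  also have "\<dots> = ?c * (\<Sum>i<n. \<Sum>j<n. if charged i j then p j * oflow j powr (k - 1) else 0)"
    by (simp add: sum_distrib_left)
  also have "(\<Sum>i<n. \<Sum>j<n. if charged i j then p j * oflow j powr (k - 1) else 0) =
      (\<Sum>j<n. \<Sum>i<n. if charged i j then p j * oflow j powr (k - 1) else 0)"
    by (rule sum.swap)
  also have "\<dots> \<le> (\<Sum>j<n. real m * (1 + s) * oflow j powr k)"
  proof (rule sum_mono)
    fix j assume "j \<in> {..<n}"
    then have j: "j < n" by simp
    have "(\<Sum>i<n. if charged i j then p j * oflow j powr (k - 1) else 0) =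
        (\<Sum>i\<in>{i. i < n \<and> charged i j}. p j * oflow j powr (k - 1))"
      by (subst sum.inter_filter[symmetric]) (auto intro!: sum.cong)
    also have "\<dots> = p j * card {i. i < n \<and> charged i j} * oflow j powr (k - 1)"
      by simp
    also have "\<dots> \<le> real m * (1 + s) * oflow j * oflow j powr (k - 1)"
      using charged_count_le[OF j] by (intro mult_right_mono) auto
    also have "\<dots> = real m * (1 + s) * oflow j powr k"
      using p_le_oflow[OF j] S.p_pos[OF j] by (simp add: powr_mult_base)
    finally show "(\<Sum>i<n. if charged i j then p j * oflow j powr (k - 1) else 0) \<le>
        real m * (1 + s) * oflow j powr k" .
  qed
  also have "\<dots> = real m * (1 + s) * (\<Sum>j<n. oflow j powr k)"
    by (simp add: sum_distrib_left)
  also have "?c * (real m * (1 + s) * (\<Sum>j<n. oflow j powr k)) =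
      (1 + s) * (2 * real m * (2 * real m) powr (k - 1)) * (\<Sum>j<n. oflow j powr k)"
    by (simp add: mult_ac)
  also have "2 * real m * (2 * real m) powr (k - 1) = (2 * real m) powr k"
    by (simp add: powr_mult_base)
  finally show ?thesis by (simp add: mult_left_mono)
qed

lemma sum_flow_powr_le:
  assumes k: "1 \<le> k" and e: "s = 1 + e" "0 < e" "e \<le> 1 / 2"
  shows "(\<Sum>i<n. flow i powr k) \<le> (7 / e) powr k * (\<Sum>j<n. oflow j powr k)"
proof -
  have m: "0 < real m" using S.m_pos by simp
  let ?O = "\<Sum>j<n. oflow j powr k"
  have O: "0 \<le> ?O" by (intro sum_nonneg) auto
  let ?B = "\<lambda>i. 7 / (5 * (real m * e)) * vol i"
  have "flow i powr k \<le> 2 / 7 * (7 / e * oflow i) powr k + 5 / 7 * (?B i) powr k" if i: "i < n" for i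
  proof -
    have po: "p i \<le> oflow i" "0 < oflow i" using p_le_oflow[OF i] S.p_pos[OF i] by auto
    have "real m * e * flow i \<le> 2 * real m * p i + vol i"
      using flow_le_vol[OF i] e by simp
    also have "\<dots> \<le> 2 * real m * oflow i + vol i"
      using po m by simp
    finally have "flow i \<le> 2 / e * oflow i + vol i / (real m * e)"
      using m e by (simp add: field_simps)
    then have "flow i powr k \<le> (2 / e * oflow i + vol i / (real m * e)) powr k"
      using flow_pos[OF i] k by (intro powr_mono2) auto
    \<comment> \<open>weights proportional to the bounds \<open>2 / \<epsilon>\<close> and \<open>5 / \<epsilon>\<close> on the norms of the two terms\<close>
    also have "\<dots> \<le> 2 / 7 * (2 / e * oflow i / (2 / 7)) powr k +
        (1 - 2 / 7) * (vol i / (real m * e) / (1 - 2 / 7)) powr k"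
      using po e m vol_nonneg k by (intro powr_add_le_convex) auto
    also have "\<dots> = 2 / 7 * (7 / e * oflow i) powr k + 5 / 7 * (?B i) powr k"
      by (simp add: field_simps)
    finally show ?thesis .
  qed
  then have "(\<Sum>i<n. flow i powr k) \<le> (\<Sum>i<n. 2 / 7 * (7 / e * oflow i) powr k + 5 / 7 * (?B i) powr k)"
    by (intro sum_mono) auto
  also have "\<dots> = 2 / 7 * (7 / e) powr k * ?O + 5 / 7 * ((7 / (5 * (real m * e))) powr k * (\<Sum>i<n. vol i powr k))"
    unfolding powr_mult by (simp add: sum.distrib sum_distrib_left mult.assoc)
  also have "(7 / (5 * (real m * e))) powr k * (\<Sum>i<n. vol i powr k) \<le>
      (7 / (5 * (real m * e))) powr k * ((1 + s) * (2 * real m) powr k * ?O)"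
    using sum_vol_powr_le[OF k] by (intro mult_left_mono) auto
  also have "\<dots> = (1 + s) * (7 / (5 * (real m * e)) * (2 * real m)) powr k * ?O"
    by (simp only: powr_mult mult_ac)
  also have "7 / (5 * (real m * e)) * (2 * real m) = 2 / 5 * (7 / e)"
    using m e by (simp add: field_simps)
  also have "(1 + s) * (2 / 5 * (7 / e)) powr k * ?O \<le> (7 / e) powr k * ?O"
  proof (rule mult_right_mono[OF _ O])
    \<comment> \<open>For a base below 1 the power is at most the base, and
      \<open>1 + s = 2 + e \<le> 5 / 2\<close>, so the product is at most 1 for every
      \<open>k\<close>.\<close>
    have "(2 / 5 :: real) powr k \<le> (2 / 5) powr 1"
      using k by (intro powr_mono') auto
    then have "(1 + s) * (2 / 5) powr k \<le> (5 / 2) * (2 / 5)"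
      using e by (intro mult_mono) auto
    then show "(1 + s) * (2 / 5 * (7 / e)) powr k \<le> (7 / e) powr k"
      unfolding powr_mult using mult_right_mono[of _ 1 "(7 / e) powr k"]
      by (simp add: mult.assoc[symmetric])
  qed
  finally show ?thesis by (simp add: algebra_simps)
qed

end

section \<open>From power sums to the competitive ratio\<close>

theorem theorem2:
  fixes n m :: nat and r p :: "nat \<Rightarrow> real" and k \<epsilon> :: real and S :: schedule
  assumes "m \<ge> 1" and "k \<ge> 1" and "0 < \<epsilon>" and "\<epsilon> \<le> 1 / 2"
    and "\<And>i. i < n \<Longrightarrow> r i \<ge> 0"
    and "\<And>i. i < n \<Longrightarrow> p i > 0"
    and "srpt_schedule n m (1 + \<epsilon>) r p S"
  shows "flow_norm n m (1 + \<epsilon>) r p k S \<le> ereal (4 / \<epsilon>\<^sup>2) * opt_flow_norm n m 1 r p k"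
proof -
  interpret S: srpt n m "1 + \<epsilon>" r p S
    by unfold_locales (use assms in \<open>auto simp: srpt_schedule_def\<close>)
  define X where "X = (\<Sum>i<n. (S.C i - r i) powr k) powr (1 / k)"
  define c where "c = 4 / \<epsilon>\<^sup>2"
  have c: "0 < c" using assms by (simp add: c_def)
  have X: "flow_norm n m (1 + \<epsilon>) r p k S = ereal X"
    by (simp add: flow_norm_def X_def S.all_complete)
  \<comment> \<open>Dividing by \<open>c\<close> leaves a lower bound to be checked against each
    competitor separately; one that leaves a job unfinished costs infinity.\<close>
  have "ereal (X / c) \<le> opt_flow_norm n m 1 r p k"
    unfolding opt_flow_norm_def
  proof (rule INF_greatest)
    fix \<tau> assume "\<tau> \<in> {\<sigma>. valid_schedule n m 1 r p \<sigma>}"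
    then have valid: "valid_schedule n m 1 r p \<tau>" by simp
    show "ereal (X / c) \<le> flow_norm n m 1 r p k \<tau>"
    proof (cases "\<forall>i<n. completes m 1 r p \<tau> i")
      case False
      then show ?thesis by (auto simp: flow_norm_def)
    next
      case True
      interpret srpt_vs n m "1 + \<epsilon>" r p S \<tau>
        by unfold_locales (use assms valid True in auto)
      define Y where "Y = (\<Sum>j<n. oflow j powr k) powr (1 / k)"
      have "(\<Sum>i<n. flow i powr k) \<le> (7 / \<epsilon>) powr k * (\<Sum>j<n. oflow j powr k)"
        using assms by (intro sum_flow_powr_le) auto
      then have "X \<le> ((7 / \<epsilon>) powr k * (\<Sum>j<n. oflow j powr k)) powr (1 / k)"
        unfolding X_def flow_def[symmetric] using assms(2)
        by (intro powr_mono2) (auto intro!: sum_nonneg)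
      also have "\<dots> = 7 / \<epsilon> * Y"
        unfolding Y_def powr_mult using assms by (simp add: powr_powr)
      also have "\<dots> \<le> c * Y"
      proof (rule mult_right_mono)
        \<comment> \<open>This is where the bound \<open>7 / \<epsilon>\<close> is weakened to
          \<open>4 / \<epsilon>\<^sup>2\<close>, by \<open>\<epsilon> \<le> 1 / 2\<close>.\<close>
        have "7 * \<epsilon> \<le> 4" using assms by simp
        then show "7 / \<epsilon> \<le> c" using assms by (simp add: c_def field_simps power2_eq_square)
      qed (simp add: Y_def)
      finally have "X / c \<le> Y" using c by (simp add: field_simps)
      then show ?thesis using True by (simp add: flow_norm_def Y_def oflow_def)
    qed
  qed
  then have "ereal c * ereal (X / c) \<le> ereal c * opt_flow_norm n m 1 r p k"
    using c by (intro ereal_mult_left_mono) auto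
  then show ?thesis using c by (simp add: X c_def)
qed

end
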